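(* If $G=(V,E)$ is a $2$-edge-connected graph on $n$ vertices, then $H(G) \ge H(C_n)$, with equality if and only if $G \cong C_n$.
   Context: Graphs are finite and simple. $C_n$ denotes the cycle on $n$ vertices. A graph is $2$-edge-connected if it is connected and remains connected after deleting any single edge (for simple graphs this forces $n\ge 3$). The Harary index of a graph $G=(V,E)$ is $H(G)=\sum_{\{u,v\}\subseteq V,\,u\ne v} \frac{1}{d(u,v)}$, where $d(u,v)$ is the distance between $u$ and $v$ in $G$. *)

theory Defs
  imports Complex_Main
begin

locale fin_sgraph =
  fixes V :: "'a set" and E :: "'a set set"
  assumes finite_verts: "finite V"
    and edge_in_verts: "e \<in> E \<Longrightarrow> e \<subseteq> V"
    and edge_card: "e \<in> E \<Longrightarrow> card e = 2"

text \<open>A walk is given by its nonempty list of vertices, so its length is one less than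
  the length of the list.\<close>

definition walk_betw :: "'a set \<Rightarrow> 'a set set \<Rightarrow> 'a \<Rightarrow> 'a list \<Rightarrow> 'a \<Rightarrow> bool" where
  "walk_betw V E u xs v \<longleftrightarrow>
     xs \<noteq> [] \<and> hd xs = u \<and> last xs = v \<and> set xs \<subseteq> V \<and> successively (\<lambda>x y. {x, y} \<in> E) xs"

definition graph_connected :: "'a set \<Rightarrow> 'a set set \<Rightarrow> bool" where
  "graph_connected V E \<longleftrightarrow> V \<noteq> {} \<and> (\<forall>u\<in>V. \<forall>v\<in>V. \<exists>xs. walk_betw V E u xs v)"

text \<open>The one-vertex graph satisfies the condition on edge deletions vacuously; it is excluded
  by the usual convention. The bound \<open>card V \<ge> 3\<close> then follows, see below.\<close>

definition two_edge_connected :: "'a set \<Rightarrow> 'a set set \<Rightarrow> bool" where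
  "two_edge_connected V E \<longleftrightarrow>
     1 < card V \<and> graph_connected V E \<and> (\<forall>e\<in>E. graph_connected V (E - {e}))"

text \<open>Only meaningful when some walk joins \<open>u\<close> and \<open>v\<close>, as in a connected graph.\<close>

definition graph_dist :: "'a set \<Rightarrow> 'a set set \<Rightarrow> 'a \<Rightarrow> 'a \<Rightarrow> nat" where
  "graph_dist V E u v = (LEAST k. \<exists>xs. walk_betw V E u xs v \<and> length xs = Suc k)"

text \<open>The distance as a function of the unordered pair; well defined by symmetry, see
  \<open>pair_dist_doubleton\<close>.\<close>

definition pair_dist :: "'a set \<Rightarrow> 'a set set \<Rightarrow> 'a set \<Rightarrow> nat" where
  "pair_dist V E p = (THE k. \<exists>u v. p = {u, v} \<and> k = graph_dist V E u v)"

definition harary_index :: "'a set \<Rightarrow> 'a set set \<Rightarrow> real" where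
  "harary_index V E = (\<Sum>p | p \<subseteq> V \<and> card p = 2. 1 / real (pair_dist V E p))"

definition cycle_verts :: "nat \<Rightarrow> nat set" where
  "cycle_verts n = {..<n}"

text \<open>A simple graph, and the cycle on \<open>n\<close> vertices, for \<open>n \<ge> 3\<close>.\<close>

definition cycle_edges :: "nat \<Rightarrow> nat set set" where
  "cycle_edges n = {{i, Suc i mod n} | i. i < n}"

definition graph_iso :: "'a set \<Rightarrow> 'a set set \<Rightarrow> 'b set \<Rightarrow> 'b set set \<Rightarrow> bool" where
  "graph_iso V E V' E' \<longleftrightarrow>
     (\<exists>f. bij_betw f V V' \<and> (\<forall>u\<in>V. \<forall>v\<in>V. {u, v} \<in> E \<longleftrightarrow> {f u, f v} \<in> E'))"

lemma walk_betw_rev: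
  assumes "walk_betw V E u xs v"
  shows "walk_betw V E v (rev xs) u"
  using assms by (auto simp: walk_betw_def hd_rev last_rev successively_rev insert_commute)

lemma graph_dist_commute: "graph_dist V E u v = graph_dist V E v u"
proof -
  have "(\<exists>xs. walk_betw V E u xs v \<and> length xs = Suc k) \<longleftrightarrow>
        (\<exists>xs. walk_betw V E v xs u \<and> length xs = Suc k)" for k
    by (metis walk_betw_rev length_rev)
  then show ?thesis by (simp add: graph_dist_def)
qed

lemma pair_dist_doubleton: "pair_dist V E {u, v} = graph_dist V E u v"
  unfolding pair_dist_def
  by (rule the_equality) (auto simp: doubleton_eq_iff graph_dist_commute)

lemma graph_connected_has_incident_edge:
  assumes "graph_connected V E" "u \<in> V" "v \<in> V" "u \<noteq> v"
  obtains w where "w \<in> V" "{u, w} \<in> E"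
proof -
  obtain xs where xs: "walk_betw V E u xs v"
    using assms by (auto simp: graph_connected_def)
  then obtain w ys where "xs = u # w # ys"
    using assms(4) by (cases xs; cases "tl xs") (auto simp: walk_betw_def)
  with xs that show thesis by (auto simp: walk_betw_def)
qed

lemma two_edge_connected_card_ge_3:
  assumes "fin_sgraph V E" "two_edge_connected V E"
  shows "3 \<le> card V"
proof (rule ccontr)
  interpret fin_sgraph V E by fact
  assume "\<not> 3 \<le> card V"
  with assms(2) have "card V = 2" by (auto simp: two_edge_connected_def)
  then obtain a b where ab: "V = {a, b}" "a \<noteq> b" by (auto simp: card_2_iff)
  have only: "e = {a, b}" if "e \<in> E" for e
    using card_subset_eq[OF finite_verts edge_in_verts[OF that]] edge_card[OF that]
      \<open>card V = 2\<close> ab by simp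
  obtain w where "{a, w} \<in> E"
    using graph_connected_has_incident_edge[of V E a b] assms(2) ab
    by (auto simp: two_edge_connected_def)
  then have "{a, b} \<in> E" using only by metis
  then have "graph_connected V (E - {{a, b}})"
    using assms(2) by (auto simp: two_edge_connected_def)
  then obtain w' where "{a, w'} \<in> E - {{a, b}}"
    using graph_connected_has_incident_edge[of V _ a b] ab by blast
  with only show False by blast
qed

lemma fin_sgraph_cycle:
  assumes "3 \<le> n"
  shows "fin_sgraph (cycle_verts n) (cycle_edges n)"
proof
  fix e assume "e \<in> cycle_edges n"
  then obtain i where i: "i < n" "e = {i, Suc i mod n}" by (auto simp: cycle_edges_def)
  then show "e \<subseteq> cycle_verts n" by (auto simp: cycle_verts_def)
  have "Suc i mod n \<noteq> i" using i(1) assms by (cases "Suc i = n") auto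
  then show "card e = 2" using i by simp
qed (simp add: cycle_verts_def)

end

theory Submission imports Defs begin

text \<open>
  If around every vertex every distance layer except the last contains at least two vertices, then
  the reciprocal distances from each vertex sum to at least the corresponding sum in the cycle, with
  equality only if that vertex has degree 2; a connected 2-regular graph is a cycle. Otherwise some
  layer \<open>k\<close> around a vertex \<open>u\<close> is a single vertex \<open>w\<close>, which separates the vertices
  nearer to \<open>u\<close> from those farther away. The two parts sharing \<open>w\<close> are again
  2-edge-connected, so induction applies to both. In either part the first layer around \<open>w\<close> has
  at least two vertices and the later ones are nonempty. This alone makes the reciprocal distances
  between the parts sum to more than what \<open>H(C\<^sub>n)\<close> gains over the two smaller cycles.
\<close>

section \<open>The cycle sums and the inequality for gluing two cycles at a vertex\<close>

text \<open>The sum of the reciprocal distances from one vertex of the cycle on \<open>m + 1\<close>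
  vertices: two vertices at each distance, except that for odd \<open>m\<close> the last distance
  occurs once.\<close>

definition half_sum :: "nat \<Rightarrow> real" where
  "half_sum m = (\<Sum>i<m. 1 / (real (i div 2) + 1))"

text \<open>The Harary index of the cycle on \<open>m + 1\<close> vertices: in terms of \<open>m\<close>, gluing two
  cycles at a vertex is addition.\<close>

definition cycle_harary :: "nat \<Rightarrow> real" where
  "cycle_harary m = (real m + 1) * half_sum m / 2"

text \<open>Sorted by distance from the cut vertex, the \<open>i\<close>-th other vertex of a part (counting from 0)
  has distance at most \<open>max 1 i\<close>.\<close>

definition cross_sum :: "nat \<Rightarrow> nat \<Rightarrow> real" where
  "cross_sum m k = (\<Sum>i<m. \<Sum>j<k. 1 / (real (max 1 i) + real (max 1 j)))"

lemma half_sum_Suc: "half_sum (Suc m) = half_sum m + 1 / (real (m div 2) + 1)"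
  by (simp add: half_sum_def)

text \<open>Clears \<open>div\<close>. The parity of \<open>m\<close> survives only as a choice
  between two linear denominators, which can be compared with those in
  \<open>cross_sum\<close>.\<close>

lemma inverse_Suc_half:
  "1 / (real (m div 2) + 1) = 2 / (real m + (if even m then 2 else 1))"
proof -
  have "real m + (if even m then 2 else 1) = 2 * (real (m div 2) + 1)"
    by (auto elim!: evenE oddE)
  moreover have "1 / x = 2 / (2 * x)" for x :: real by simp
  ultimately show ?thesis by metis
qed

lemma half_sum_Suc_div_2:
  "half_sum (Suc m) / 2 = half_sum m / 2 + 1 / (real m + (if even m then 2 else 1))"
proof -
  have "2 / x / 2 = 1 / x" for x :: real by simp
  then show ?thesis
    by (simp only: half_sum_Suc inverse_Suc_half add_divide_distrib)
qed

lemma cycle_harary_Suc: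
  "cycle_harary (Suc m) =
     cycle_harary m + half_sum m / 2 + (if even m then 1 else 1 + 1 / (real m + 1))"
proof -
  have "(real m + 2) * (1 / (real (m div 2) + 1)) = 2 * (if even m then 1 else 1 + 1 / (real m + 1))"
    unfolding inverse_Suc_half by (simp add: divide_simps)
  then show ?thesis
    by (simp add: cycle_harary_def half_sum_Suc algebra_simps add_divide_distrib)
qed

text \<open>What gluing a triangle comes down to. The base \<open>k = 2\<close> reads 5/2 < 3;
  afterwards each new term on the left is at most the new one on the right, so strictness
  persists.\<close>

lemma half_sum_le_shifted:
  assumes "2 \<le> k"
  shows "half_sum (Suc k) < 1 + 2 * (\<Sum>j<k. 1 / (1 + real (max 1 j)))"
  using assms
proof (induction k rule: dec_induct)
  case base
  show ?case by (simp add: half_sum_def numeral_eq_Suc)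
next
  case (step k)
  have "1 / (real (Suc k div 2) + 1) \<le> 2 / (1 + real k)"
    by (cases "even k") (auto elim!: evenE oddE simp: field_simps)
  with step show ?case by (simp add: half_sum_Suc[of "Suc k"] max_def)
qed

lemma cycle_harary_split_two:
  assumes "2 \<le> k"
  shows "cycle_harary (2 + k) < cycle_harary 2 + cycle_harary k + cross_sum 2 k"
proof -
  \<comment> \<open>Two increments of \<open>cycle_harary\<close> are added. After half of
    \<open>half_sum k\<close> is replaced by half of \<open>half_sum (Suc k)\<close>, the remaining
    fractions cancel and leave 2 for either parity.\<close>
  have "cycle_harary (2 + k) = cycle_harary k + 2 + half_sum (Suc k)"
    using cycle_harary_Suc[of k] cycle_harary_Suc[of "Suc k"] half_sum_Suc_div_2[of k]
    by (cases "even k") (simp_all add: algebra_simps)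
  moreover have "cycle_harary 2 = 3" by (simp add: cycle_harary_def half_sum_def numeral_eq_Suc)
  \<comment> \<open>Rows 0 and 1 coincide because \<open>max 1 0 = max 1 1\<close>.\<close>
  moreover have "cross_sum 2 k = 2 * (\<Sum>j<k. 1 / (1 + real (max 1 j)))"
    by (simp add: cross_sum_def numeral_eq_Suc)
  ultimately show ?thesis using half_sum_le_shifted[OF assms] by simp
qed

text \<open>Half of each increment of \<open>half_sum\<close> is at most the matching reciprocal on
  the right. For even \<open>m\<close> the first comparison is \<open>1 / (m + 2)\<close> against
  \<open>1 / (m + 1)\<close>; this gap is recorded because \<open>cycle_harary_split_le\<close>
  depends on it.\<close>

lemma half_sum_diff_le:
  assumes "0 < k"
  shows "(half_sum (m + k) - half_sum m) / 2 + (if even m then 1 / (real m + 1) - 1 / (real m + 2) else 0)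
           \<le> (\<Sum>j<k. 1 / (real m + real j + 1))"
  using assms
proof (induction k rule: nat_induct_non_zero)
  case 1
  have "(half_sum (Suc m) - half_sum m) / 2 = 1 / (real m + (if even m then 2 else 1))"
    unfolding diff_divide_distrib half_sum_Suc_div_2 by simp
  then show ?case unfolding One_nat_def add_Suc_right add_0_right
    by (simp only:) simp
next
  case (Suc k)
  have "half_sum (m + Suc k) / 2 \<le> half_sum (m + k) / 2 + 1 / (real m + real k + 1)"
    using half_sum_Suc_div_2[of "m + k"]
    by (simp only: add_Suc_right) (auto intro!: divide_left_mono)
  with Suc show ?case by (simp add: diff_divide_distrib)
qed

text \<open>Truncation repeats the denominator \<open>m + 1\<close> and drops
  \<open>m + k\<close>.\<close>

lemma sum_max_one:
  assumes "0 < k"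
  shows "(\<Sum>j<k. 1 / (real m + real (max 1 j))) + 1 / (real m + real k) =
           1 / (real m + 1) + (\<Sum>j<k. 1 / (real m + real j + 1))"
  using assms by (induction k rule: nat_induct_non_zero) (auto simp: max_def algebra_simps)

text \<open>Induction on the smaller part: raising \<open>m\<close> by one adds a row to the cross
  sum, and this row covers the change in the cycle terms. Strictness comes from the base
  \<open>m = 2\<close>.\<close>

lemma cycle_harary_split_le:
  assumes "2 \<le> m" "m \<le> k"
  shows "cycle_harary (m + k) < cycle_harary m + cycle_harary k + cross_sum m k"
  using assms
proof (induction m rule: dec_induct)
  case base
  then show ?case using cycle_harary_split_two by simp
next
  case (step m)
  have row: "cross_sum (Suc m) k = cross_sum m k + (\<Sum>j<k. 1 / (real m + real (max 1 j)))"
    using step.hyps by (simp add: cross_sum_def max_def)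
  define \<epsilon> where "\<epsilon> i = (if even i then 1 else 1 + 1 / (real i + 1))" for i :: nat
  have k: "0 < k" using step.prems by simp
  have \<epsilon>: "\<epsilon> (m + k) \<le> 1 + 1 / (real m + real k + 1)" by (simp add: \<epsilon>_def)
  \<comment> \<open>The induction step has \<open>Suc m \<le> k\<close>, so \<open>m + k\<close> is
    at least \<open>2 * m + 1\<close>.\<close>
  have mono: "1 / (real m + real k) \<le> 1 / (2 * real m + 1)"
      "1 / (real m + real k + 1) \<le> 1 / (2 * real m + 2)"
    using step.prems by (auto intro!: divide_left_mono)
  \<comment> \<open>What remains for even \<open>m\<close>, with the gap from
    \<open>half_sum_diff_le\<close> used up. For odd \<open>m\<close> the extra
    \<open>1 / (m + 1)\<close> in \<open>\<epsilon> m\<close> exceeds that gap by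
    \<open>1 / (m + 2)\<close>, whence \<open>pos\<close>.\<close>
  have ineq: "1 / (2 * real m + 1) + 1 / (2 * real m + 2) \<le> 1 / (real m + 1) + 1 / (real m + 1) - 1 / (real m + 2)"
    by (simp add: divide_simps) (simp add: algebra_simps)
  have pos: "0 \<le> 1 / (real m + 2)" by simp
  have "(half_sum (m + k) - half_sum m) / 2 + \<epsilon> (m + k) - \<epsilon> m
          \<le> (\<Sum>j<k. 1 / (real m + real (max 1 j)))"
    using half_sum_diff_le[OF k, of m] sum_max_one[OF k, of m] \<epsilon> mono ineq pos \<epsilon>_def[of m]
    by argo
  moreover have "cycle_harary (m + k) < cycle_harary m + cycle_harary k + cross_sum m k"
    using step by simp
  moreover have "cycle_harary (Suc i) = cycle_harary i + half_sum i / 2 + \<epsilon> i" for i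
    unfolding \<epsilon>_def by (rule cycle_harary_Suc)
  ultimately show ?case using row by (simp add: diff_divide_distrib del: of_nat_max)
qed

lemma cross_sum_commute: "cross_sum m k = cross_sum k m"
  unfolding cross_sum_def by (subst sum.swap) (simp add: add.commute)

lemma cycle_harary_split:
  assumes "2 \<le> m" "2 \<le> k"
  shows "cycle_harary (m + k) < cycle_harary m + cycle_harary k + cross_sum m k"
proof (cases "m \<le> k")
  case False
  then show ?thesis
    using cycle_harary_split_le[of k m] assms(2) by (simp add: cross_sum_commute add.commute)
qed (use cycle_harary_split_le assms in simp)

section \<open>Enumeration in order of distance\<close>

text \<open>The enumeration sorts \<open>A\<close> by \<open>d\<close>. The first rank bound turns
  lower bounds on ball sizes into upper bounds on \<open>d (f i)\<close>; the second turns upper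
  bounds on ball sizes, available in a cycle, into lower bounds.\<close>

lemma enumerate_by_rank:
  fixes d :: "'a \<Rightarrow> nat"
  assumes "finite A"
  obtains f where "bij_betw f {..<card A} A"
    and "\<And>i. i < card A \<Longrightarrow> card {y \<in> A. d y < d (f i)} \<le> i"
    and "\<And>i. i < card A \<Longrightarrow> i < card {y \<in> A. d y \<le> d (f i)}"
proof -
  obtain xs where xs: "set xs = A" "distinct xs" using finite_distinct_list[OF assms] by blast
  define ys where "ys = sort_key d xs"
  have ys: "set ys = A" "distinct ys" "length ys = card A" "sorted (map d ys)"
    using xs distinct_card[OF xs(2)] by (simp_all add: ys_def)
  have bij: "bij_betw ((!) ys) {..<card A} A" using bij_betw_nth[OF ys(2)] ys by simp
  have mono: "d (ys ! i) \<le> d (ys ! j)" if "i \<le> j" "j < card A" for i j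
    using sorted_nth_mono[OF ys(4)] that ys(3) by simp
  show thesis
  proof
    fix i assume i: "i < card A"
    have "{y \<in> A. d y < d (ys ! i)} \<subseteq> (!) ys ` {..<i}"
    proof
      fix y assume y: "y \<in> {y \<in> A. d y < d (ys ! i)}"
      then obtain j where "j < card A" "y = ys ! j" using bij by (auto simp: bij_betw_def)
      with y mono[of i j] show "y \<in> (!) ys ` {..<i}" by (cases "j < i") auto
    qed
    from surj_card_le[OF _ this] show "card {y \<in> A. d y < d (ys ! i)} \<le> i" by simp
    have "(!) ys ` {..i} \<subseteq> {y \<in> A. d y \<le> d (ys ! i)}"
      using mono i bij by (auto simp: bij_betw_def)
    moreover have "inj_on ((!) ys) {..i}"
      using bij i by (auto simp: bij_betw_def intro: inj_on_subset)
    ultimately have "card {..i} \<le> card {y \<in> A. d y \<le> d (ys ! i)}"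
      using assms by (intro card_inj_on_le) auto
    then show "i < card {y \<in> A. d y \<le> d (ys ! i)}" by simp
  qed (fact bij)
qed

section \<open>Walks, distances and the Harary index as a sum over ordered pairs\<close>

lemma walk_betw_single: "u \<in> V \<Longrightarrow> walk_betw V E u [u] u"
  by (simp add: walk_betw_def)

lemma walk_betw_append:
  assumes "walk_betw V E u xs v" "walk_betw V E v ys z"
  shows "walk_betw V E u (xs @ tl ys) z"
proof -
  obtain zs where "ys = v # zs" using assms(2) by (cases ys) (auto simp: walk_betw_def)
  with assms show ?thesis
    by (cases zs) (auto simp: walk_betw_def successively_append_iff)
qed

lemma walk_betw_mono:
  assumes "walk_betw V E u xs v" "V \<subseteq> V'" "E \<subseteq> E'"
  shows "walk_betw V' E' u xs v"
  using assms by (auto simp: walk_betw_def intro: successively_mono)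

lemma graph_dist_le: "walk_betw V E u xs v \<Longrightarrow> length xs = Suc k \<Longrightarrow> graph_dist V E u v \<le> k"
  unfolding graph_dist_def by (rule Least_le) blast

lemma shortest_walk:
  assumes "walk_betw V E u xs v"
  obtains ys where "walk_betw V E u ys v" "length ys = Suc (graph_dist V E u v)"
proof -
  have "length xs = Suc (length xs - 1)" using assms by (auto simp: walk_betw_def)
  with assms have "\<exists>k ys. walk_betw V E u ys v \<and> length ys = Suc k" by blast
  from LeastI_ex[OF this] show thesis using that unfolding graph_dist_def by blast
qed

lemma graph_dist_self: "u \<in> V \<Longrightarrow> graph_dist V E u u = 0"
  using graph_dist_le[OF walk_betw_single, of u V 0 E] by simp

locale connected_sgraph = fin_sgraph V E for V :: "'a set" and E +
  assumes connected: "graph_connected V E"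
begin

abbreviation "d \<equiv> graph_dist V E"

lemma geodesic:
  assumes "u \<in> V" "v \<in> V"
  obtains xs where "walk_betw V E u xs v" "length xs = Suc (d u v)"
  using assms connected shortest_walk[of V E u _ v] unfolding graph_connected_def by blast

lemma adjacent_in_verts:
  assumes "{u, v} \<in> E"
  shows "u \<in> V" "v \<in> V" "u \<noteq> v"
  using edge_in_verts[OF assms] edge_card[OF assms] by auto

lemma dist_eq_0_iff:
  assumes "u \<in> V" "v \<in> V"
  shows "d u v = 0 \<longleftrightarrow> u = v"
proof
  assume "d u v = 0"
  then obtain xs where "walk_betw V E u xs v" "length xs = 1" using geodesic[OF assms] by auto
  then show "u = v" by (auto simp: walk_betw_def length_Suc_conv)
qed (use assms graph_dist_self in auto)

lemma dist_triangle:
  assumes "u \<in> V" "v \<in> V" "z \<in> V"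
  shows "d u z \<le> d u v + d v z"
proof -
  obtain xs where xs: "walk_betw V E u xs v" "length xs = Suc (d u v)" by (rule geodesic[OF assms(1,2)])
  obtain ys where ys: "walk_betw V E v ys z" "length ys = Suc (d v z)" by (rule geodesic[OF assms(2,3)])
  show ?thesis using graph_dist_le[OF walk_betw_append[OF xs(1) ys(1)]] xs(2) ys(2) by simp
qed

lemma dist_eq_1_iff:
  assumes "u \<in> V" "v \<in> V"
  shows "d u v = 1 \<longleftrightarrow> {u, v} \<in> E"
proof
  assume "d u v = 1"
  then obtain xs where "walk_betw V E u xs v" "length xs = Suc (Suc 0)" using geodesic[OF assms] by auto
  then show "{u, v} \<in> E" by (auto simp: walk_betw_def length_Suc_conv)
next
  assume e: "{u, v} \<in> E"
  then have "walk_betw V E u [u, v] v" using assms by (simp add: walk_betw_def)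
  then have "d u v \<le> 1" by (rule graph_dist_le) simp
  moreover have "d u v \<noteq> 0" using dist_eq_0_iff[OF assms] adjacent_in_verts[OF e] by simp
  ultimately show "d u v = 1" by simp
qed

lemma dist_adjacent_le:
  assumes "u \<in> V" "{x, y} \<in> E"
  shows "d u y \<le> Suc (d u x)"
  using dist_triangle[OF assms(1) adjacent_in_verts(1,2)[OF assms(2)]]
    dist_eq_1_iff[OF adjacent_in_verts(1,2)[OF assms(2)]] assms(2) by simp

lemma dist_predecessor:
  assumes "u \<in> V" "v \<in> V" "d u v = Suc k"
  obtains y where "y \<in> V" "{y, v} \<in> E" "d u y = k"
proof -
  obtain xs where xs: "walk_betw V E u xs v" "length xs = Suc (Suc k)"
    using geodesic[OF assms(1,2)] assms(3) by metis
  then obtain ys where ys: "xs = ys @ [v]" "length ys = Suc k"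
    by (cases xs rule: rev_cases) (auto simp: walk_betw_def)
  then obtain zs y where zs: "ys = zs @ [y]" by (cases ys rule: rev_cases) auto
  have w: "walk_betw V E u ys y" "{y, v} \<in> E"
    using xs ys zs by (auto simp: walk_betw_def successively_append_iff hd_append split: if_splits)
  \<comment> \<open>Dropping the last vertex of the geodesic bounds the distance from above;
    adjacency to \<open>v\<close> bounds it from below.\<close>
  have "d u y \<le> k" by (rule graph_dist_le[OF w(1) ys(2)])
  moreover have "Suc k \<le> Suc (d u y)" using dist_adjacent_le[OF assms(1) w(2)] assms(3) by simp
  ultimately show thesis using that w(2) adjacent_in_verts by simp
qed

text \<open>Go back from \<open>v\<close> through predecessors, each one step nearer to
  \<open>u\<close>, until the distance is \<open>k\<close>.\<close>

lemma layer_nonempty: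
  assumes "u \<in> V" "v \<in> V" "k \<le> d u v"
  shows "\<exists>y\<in>V. d u y = k"
  using assms(2,3)
proof (induction "d u v - k" arbitrary: v)
  case 0
  then show ?case by auto
next
  case (Suc m)
  then obtain l where l: "d u v = Suc l" by (cases "d u v") auto
  obtain y where y: "y \<in> V" "d u y = l" using dist_predecessor[OF assms(1) Suc.prems(1) l] by metis
  show ?case
  proof (cases "k = Suc l")
    case False
    with Suc.hyps(1)[of y] Suc.hyps(2) Suc.prems l y show ?thesis by simp
  qed (use Suc.prems l in auto)
qed

text \<open>The diagonal terms are \<open>1 / 0 = 0\<close>.\<close>

lemma harary_index_eq_sum:
  "2 * harary_index V E = (\<Sum>u\<in>V. \<Sum>v\<in>V. 1 / real (d u v))"
proof -
  let ?S = "{(u, v). u \<in> V \<and> v \<in> V \<and> u \<noteq> v}"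
  let ?T = "{p. p \<subseteq> V \<and> card p = 2}"
  let ?g = "\<lambda>(u, v). 1 / real (d u v)"
  have finS: "finite ?S" by (rule finite_subset[of _ "V \<times> V"]) (auto simp: finite_verts)
  have finT: "finite ?T" using finite_verts by simp
  have "(\<Sum>u\<in>V. \<Sum>v\<in>V. 1 / real (d u v)) = sum ?g (V \<times> V)"
    by (simp add: sum.cartesian_product)
  also have "\<dots> = sum ?g ?S"
    by (rule sum.mono_neutral_right) (auto simp: finite_verts graph_dist_self)
  \<comment> \<open>Ordered pairs are grouped by their underlying set; each fibre consists of two
    pairs with the same distance.\<close>
  also have "\<dots> = (\<Sum>p\<in>?T. sum ?g {q \<in> ?S. (\<lambda>(u, v). {u, v}) q = p})"
    by (rule sum.group[symmetric]) (auto simp: finS finT)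
  also have "\<dots> = (\<Sum>p\<in>?T. 2 * (1 / real (pair_dist V E p)))"
  proof (rule sum.cong)
    fix p assume "p \<in> ?T"
    then obtain a b where ab: "p = {a, b}" "a \<noteq> b" "a \<in> V" "b \<in> V" by (auto simp: card_2_iff)
    then have "{q \<in> ?S. (\<lambda>(u, v). {u, v}) q = p} = {(a, b), (b, a)}"
      by (auto simp: doubleton_eq_iff)
    with ab show "sum ?g {q \<in> ?S. (\<lambda>(u, v). {u, v}) q = p} = 2 * (1 / real (pair_dist V E p))"
      by (simp add: pair_dist_doubleton graph_dist_commute[of V E b a])
  qed simp
  finally show ?thesis by (simp add: harary_index_def sum_distrib_left)
qed

end

section \<open>Distance layers and the sorted distances from a vertex\<close>

context connected_sgraph
begin

definition layer :: "'a \<Rightarrow> nat \<Rightarrow> 'a set" where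
  "layer w k = {x \<in> V. d w x = k}"

lemma finite_layer: "finite (layer w k)"
  using finite_verts by (simp add: layer_def)

lemma card_below_Suc:
  "card {y \<in> V - {w}. d w y < Suc k} = card {y \<in> V - {w}. d w y < k} + card (layer w k - {w})"
proof -
  have "{y \<in> V - {w}. d w y < Suc k} = {y \<in> V - {w}. d w y < k} \<union> (layer w k - {w})"
    by (auto simp: layer_def)
  then show ?thesis
    using finite_verts finite_layer by (simp add: card_Un_disjoint layer_def disjoint_iff)
qed

lemma card_layer_pos:
  assumes "w \<in> V" "v \<in> V" "k \<le> d w v"
  shows "0 < card (layer w k)"
  using layer_nonempty[OF assms] finite_layer[of w k] by (auto simp: card_gt_0_iff layer_def)

lemma layer_without_centre: "w \<in> V \<Longrightarrow> 0 < k \<Longrightarrow> layer w k - {w} = layer w k"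
  by (auto simp: layer_def graph_dist_self)

text \<open>A vertex at distance \<open>k \<ge> 2\<close> is preceded by two vertices of the first
  layer and at least one from each of the layers 2 to \<open>k - 1\<close>. These are at least
  \<open>k\<close> vertices, so its index is at least \<open>k\<close>.\<close>

lemma rank_le_if_first_layer_ge_2:
  assumes "w \<in> V" "2 \<le> card (layer w 1)"
  obtains f where "bij_betw f {..<card V - 1} (V - {w})"
    and "\<And>i. i < card V - 1 \<Longrightarrow> d w (f i) \<le> max 1 i"
proof -
  have card: "card (V - {w}) = card V - 1" using assms(1) by simp
  have count: "k \<le> card {y \<in> V - {w}. d w y < k}" if "2 \<le> k" "v \<in> V" "k \<le> d w v" for k v
    using that(1,3)
  proof (induction k rule: dec_induct)
    case base
    have "card {y \<in> V - {w}. d w y < Suc 1} \<ge> 2"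
      unfolding card_below_Suc[of w 1] using assms layer_without_centre[of w 1] by simp
    then show ?case by (simp add: numeral_2_eq_2)
  next
    case (step k)
    then show ?case
      using card_below_Suc[of w k] layer_without_centre[of w k] card_layer_pos[OF assms(1) that(2), of k]
        assms(1) by simp
  qed
  obtain f where f: "bij_betw f {..<card (V - {w})} (V - {w})"
    and rank: "\<And>i. i < card (V - {w}) \<Longrightarrow> card {y \<in> V - {w}. d w y < d w (f i)} \<le> i"
    using enumerate_by_rank[of "V - {w}" "d w"] finite_verts by blast
  have "d w (f i) \<le> max 1 i" if "i < card V - 1" for i
  proof (cases "2 \<le> d w (f i)")
    case True
    have "f i \<in> V" using f that card by (auto simp: bij_betw_def)
    from count[OF True this] rank[of i] that card show ?thesis by simp
  qed simp
  with f card that show thesis by simp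
qed

text \<open>A vertex at distance \<open>k + 1\<close> is preceded by \<open>k\<close> layers of at
  least two vertices each, so its index is at least \<open>2 * k\<close>. The last clause locates
  the neighbours of \<open>w\<close> in the enumeration; strictness will come from a third
  one.\<close>

lemma rank_le_if_layers_ge_2:
  assumes "w \<in> V"
    and layers: "\<And>k v. 0 < k \<Longrightarrow> v \<in> V \<Longrightarrow> k < d w v \<Longrightarrow> 2 \<le> card (layer w k)"
  obtains f where "bij_betw f {..<card V - 1} (V - {w})"
    and "\<And>i. i < card V - 1 \<Longrightarrow> d w (f i) \<le> i div 2 + 1"
    and "\<And>i. i < card (layer w 1) \<Longrightarrow> d w (f i) = 1"
proof -
  have card: "card (V - {w}) = card V - 1" using assms(1) by simp
  have count: "2 * k \<le> card {y \<in> V - {w}. d w y < Suc k}" if "v \<in> V" "Suc k \<le> d w v" for k v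
    using that(2)
  proof (induction k)
    case (Suc k)
    then show ?case
      using card_below_Suc[of w "Suc k"] layer_without_centre[of w "Suc k"]
        layers[of "Suc k" v] that(1) assms(1) by simp
  qed simp
  obtain f where f: "bij_betw f {..<card (V - {w})} (V - {w})"
    and rank: "\<And>i. i < card (V - {w}) \<Longrightarrow> card {y \<in> V - {w}. d w y < d w (f i)} \<le> i"
    using enumerate_by_rank[of "V - {w}" "d w"] finite_verts by blast
  have fV: "f i \<in> V \<and> 0 < d w (f i)" if "i < card V - 1" for i
  proof -
    have "f i \<in> V - {w}" using bij_betwE[OF f] that card by simp
    then show ?thesis using dist_eq_0_iff[OF assms(1), of "f i"] by auto
  qed
  have le: "d w (f i) \<le> i div 2 + 1" if i: "i < card V - 1" for i
  proof -
    obtain k where k: "d w (f i) = Suc k" using fV[OF i] by (cases "d w (f i)") auto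
    with count[of "f i" k] rank[of i] fV[OF i] i card show ?thesis by simp
  qed
  have one: "d w (f i) = 1" if i: "i < card (layer w 1)" for i
  proof (rule ccontr)
    assume neq: "d w (f i) \<noteq> 1"
    have sub: "layer w 1 \<subseteq> V - {w}" using assms(1) by (auto simp: layer_def graph_dist_self)
    from card_mono[OF _ this] i have i': "i < card V - 1" using finite_verts card by simp
    \<comment> \<open>If \<open>f i\<close> lay beyond the first layer, that whole layer would
      precede it, against its rank.\<close>
    have "layer w 1 \<subseteq> {y \<in> V - {w}. d w y < d w (f i)}"
      using sub fV[OF i'] neq by (auto simp: layer_def)
    from card_mono[OF _ this] rank[of i] i i' card show False using finite_verts by simp
  qed
  show thesis using that[of f] f card le one by simp
qed

lemma half_sum_le_inverse_dist_sum:
  assumes "w \<in> V"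
    and layers: "\<And>k v. 0 < k \<Longrightarrow> v \<in> V \<Longrightarrow> k < d w v \<Longrightarrow> 2 \<le> card (layer w k)"
  shows "half_sum (card V - 1) \<le> (\<Sum>v\<in>V. 1 / real (d w v))"
    and "2 < card (layer w 1) \<Longrightarrow> half_sum (card V - 1) < (\<Sum>v\<in>V. 1 / real (d w v))"
proof -
  obtain f where f: "bij_betw f {..<card V - 1} (V - {w})"
    and le: "\<And>i. i < card V - 1 \<Longrightarrow> d w (f i) \<le> i div 2 + 1"
    and one: "\<And>i. i < card (layer w 1) \<Longrightarrow> d w (f i) = 1"
    by (rule rank_le_if_layers_ge_2[OF assms]) blast+
  have "(\<Sum>v\<in>V. 1 / real (d w v)) = (\<Sum>v\<in>V - {w}. 1 / real (d w v))"
    using assms(1) finite_verts by (subst sum.remove[of _ w]) (auto simp: graph_dist_self)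
  also have "\<dots> = (\<Sum>i<card V - 1. 1 / real (d w (f i)))"
    by (rule sum.reindex_bij_betw[OF f, symmetric])
  finally have eq: "(\<Sum>v\<in>V. 1 / real (d w v)) = \<dots>" .
  have summand_le: "1 / (real (i div 2) + 1) \<le> 1 / real (d w (f i))" if "i < card V - 1" for i
  proof -
    have "f i \<in> V - {w}" using bij_betwE[OF f] that by simp
    then have "0 < d w (f i)" using dist_eq_0_iff[OF assms(1), of "f i"] by auto
    moreover have "real (d w (f i)) \<le> real (i div 2) + 1"
      using le[OF that] by linarith
    ultimately show ?thesis by (intro divide_left_mono) auto
  qed
  show "half_sum (card V - 1) \<le> (\<Sum>v\<in>V. 1 / real (d w v))"
    unfolding eq half_sum_def using summand_le by (intro sum_mono) auto
  assume deg: "2 < card (layer w 1)"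
  have "layer w 1 \<subseteq> V - {w}" using assms(1) by (auto simp: layer_def graph_dist_self)
  from card_mono[OF _ this] have "2 < card V - 1" using deg finite_verts assms(1) by simp
  \<comment> \<open>Index 2 is the first one whose term in \<open>half_sum\<close> is 1/2, whereas a
    third neighbour contributes 1.\<close>
  moreover have "1 / (real (2 div 2) + 1) < 1 / real (d w (f 2))" using one[OF deg] by simp
  ultimately have "\<exists>i\<in>{..<card V - 1}. 1 / (real (i div 2) + 1) < 1 / real (d w (f i))"
    by (intro bexI[of _ 2]) simp_all
  then show "half_sum (card V - 1) < (\<Sum>v\<in>V. 1 / real (d w v))"
    unfolding eq half_sum_def using summand_le by (intro sum_strict_mono_ex1) auto
qed

end

section \<open>Splitting a graph at a cut vertex\<close>

text \<open>The map \<open>r\<close> fixes \<open>V1\<close> and sends everything else to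
  \<open>w\<close>. An edge inside \<open>V1\<close> survives; any other edge lies inside
  \<open>V2\<close>, its ends get the same image, and it is skipped.\<close>

lemma retract_walk:
  assumes "xs \<noteq> []" "set xs \<subseteq> V1 \<union> V2" "successively (\<lambda>x y. {x, y} \<in> F) xs"
    and edges: "\<And>e. e \<in> F \<Longrightarrow> e \<subseteq> V1 \<or> e \<subseteq> V2" and cut: "V1 \<inter> V2 = {w}"
    and r: "r = (\<lambda>x. if x \<in> V1 then x else w)"
  shows "\<exists>ys. walk_betw V1 {e \<in> F. e \<subseteq> V1} (r (hd xs)) ys (r (last xs))"
  using assms(1-3)
proof (induction xs rule: induct_list012)
  case (2 x)
  have "r x \<in> V1" using cut r by auto
  then show ?case using walk_betw_single by force
next
  case (3 x y zs)
  then obtain ys where ys: "walk_betw V1 {e \<in> F. e \<subseteq> V1} (r y) ys (r (last (y # zs)))" by auto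
  have e: "{x, y} \<in> F" using 3 by simp
  show ?case
  proof (cases "x \<in> V1 \<and> y \<in> V1")
    case True
    then have "walk_betw V1 {e \<in> F. e \<subseteq> V1} x [x, y] y" using e by (simp add: walk_betw_def)
    moreover have "r x = x" "r y = y" using True by (simp_all add: r)
    ultimately have "walk_betw V1 {e \<in> F. e \<subseteq> V1} (r x) ([x, y] @ tl ys) (r (last (y # zs)))"
      using walk_betw_append[OF _ ys] by metis
    then show ?thesis by auto
  next
    case False
    then have "x \<in> V2" "y \<in> V2" using edges[OF e] by auto
    then have "x \<in> V1 \<Longrightarrow> x = w" "y \<in> V1 \<Longrightarrow> y = w" using cut by blast+
    then have "r x = r y" by (auto simp: r)
    then show ?thesis using ys by (intro exI[of _ ys]) simp
  qed
qed simp

text \<open>The retraction fixes both ends of a walk between vertices of \<open>V1\<close>. The edge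
  set \<open>F\<close> is arbitrary so that both \<open>E\<close> and \<open>E - {e}\<close> can
  take its place.\<close>

lemma graph_connected_part:
  assumes "graph_connected (V1 \<union> V2) F"
    and "\<And>e. e \<in> F \<Longrightarrow> e \<subseteq> V1 \<or> e \<subseteq> V2" "V1 \<inter> V2 = {w}"
  shows "graph_connected V1 {e \<in> F. e \<subseteq> V1}"
  unfolding graph_connected_def
proof (intro conjI ballI)
  show "V1 \<noteq> {}" using assms(3) by auto
  fix u v assume uv: "u \<in> V1" "v \<in> V1"
  then obtain xs where xs: "walk_betw (V1 \<union> V2) F u xs v"
    using assms(1) unfolding graph_connected_def by blast
  with uv retract_walk[of xs V1 V2 F w, OF _ _ _ assms(2,3) refl]
  show "\<exists>xs. walk_betw V1 {e \<in> F. e \<subseteq> V1} u xs v" by (auto simp: walk_betw_def)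
qed

lemma two_edge_connected_part:
  assumes "two_edge_connected (V1 \<union> V2) E"
    and edges: "\<And>e. e \<in> E \<Longrightarrow> e \<subseteq> V1 \<or> e \<subseteq> V2" and cut: "V1 \<inter> V2 = {w}"
    and "1 < card V1"
  shows "two_edge_connected V1 {e \<in> E. e \<subseteq> V1}"
  unfolding two_edge_connected_def
proof (intro conjI ballI)
  show "graph_connected V1 {e \<in> E. e \<subseteq> V1}"
    using graph_connected_part[OF _ edges cut] assms(1) unfolding two_edge_connected_def by blast
  fix e assume "e \<in> {e \<in> E. e \<subseteq> V1}"
  then have "graph_connected (V1 \<union> V2) (E - {e})"
    using assms(1) unfolding two_edge_connected_def by blast
  then have "graph_connected V1 {e' \<in> E - {e}. e' \<subseteq> V1}"
    by (rule graph_connected_part[OF _ _ cut]) (use edges in blast)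
  moreover have "{e' \<in> E - {e}. e' \<subseteq> V1} = {e \<in> E. e \<subseteq> V1} - {e}" by auto
  ultimately show "graph_connected V1 ({e \<in> E. e \<subseteq> V1} - {e})" by simp
qed (fact assms(4))

lemma fin_sgraph_part:
  assumes "fin_sgraph (V1 \<union> V2) E"
  shows "fin_sgraph V1 {e \<in> E. e \<subseteq> V1}"
  using assms unfolding fin_sgraph_def by auto

lemma two_edge_connected_imp_connected_sgraph:
  "fin_sgraph V E \<Longrightarrow> two_edge_connected V E \<Longrightarrow> connected_sgraph V E"
  by (simp add: connected_sgraph_def connected_sgraph_axioms_def two_edge_connected_def)

text \<open>Deleting the edge to one neighbour of \<open>w\<close> leaves the graph connected, which
  yields a second neighbour.\<close>

lemma two_edge_connected_first_layer:
  assumes "fin_sgraph V E" "two_edge_connected V E" "w \<in> V"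
  shows "2 \<le> card (connected_sgraph.layer V E w 1)"
proof -
  interpret connected_sgraph V E
    using assms two_edge_connected_imp_connected_sgraph by blast
  have "V \<noteq> {w}" using assms(2) by (auto simp: two_edge_connected_def)
  then obtain v where v: "v \<in> V" "v \<noteq> w" using assms(3) by blast
  obtain a where a: "a \<in> V" "{w, a} \<in> E"
    using graph_connected_has_incident_edge[OF connected assms(3) v(1)] v(2) by blast
  have "graph_connected V (E - {{w, a}})" using assms(2) a by (simp add: two_edge_connected_def)
  then obtain b where b: "b \<in> V" "{w, b} \<in> E - {{w, a}}"
    using graph_connected_has_incident_edge[OF _ assms(3) v(1)] v(2) by blast
  have "{a, b} \<subseteq> layer w 1" using a b dist_eq_1_iff assms(3) by (auto simp: layer_def)
  moreover have "a \<noteq> b" using b by auto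
  ultimately show ?thesis using card_mono[OF finite_layer, of "{a, b}" w 1] by simp
qed

text \<open>Every ordered pair lies within a part or crosses between the parts away from
  \<open>w\<close>, the latter in both directions. Only \<open>(w, w)\<close> lies within both
  parts, hence \<open>g w w = 0\<close>.\<close>

lemma sum_over_split:
  fixes g :: "'a \<Rightarrow> 'a \<Rightarrow> real"
  assumes fin: "finite V1" "finite V2" and cut: "V1 \<inter> V2 = {w}"
    and sym: "\<And>x y. g x y = g y x" and "g w w = 0"
  shows "(\<Sum>x\<in>V1 \<union> V2. \<Sum>y\<in>V1 \<union> V2. g x y) =
    (\<Sum>x\<in>V1. \<Sum>y\<in>V1. g x y) + (\<Sum>x\<in>V2. \<Sum>y\<in>V2. g x y)
      + 2 * (\<Sum>x\<in>V1 - {w}. \<Sum>y\<in>V2 - {w}. g x y)"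
proof -
  let ?A = "V1 - {w}" and ?B = "V2 - {w}"
  have V: "V1 = insert w ?A" "V2 = insert w ?B" "V1 \<union> V2 = insert w (?A \<union> ?B)"
    using cut by auto
  have dis: "?A \<inter> ?B = {}" using cut by auto
  have fins: "finite ?A" "finite ?B" using fin by auto
  have swap: "(\<Sum>x\<in>?B. \<Sum>y\<in>?A. g x y) = (\<Sum>x\<in>?A. \<Sum>y\<in>?B. g x y)"
    by (subst sum.swap) (intro sum.cong refl sym)
  have ins: "(\<Sum>x\<in>insert w S. \<Sum>y\<in>insert w S. g x y) =
      2 * (\<Sum>x\<in>S. g w x) + (\<Sum>x\<in>S. \<Sum>y\<in>S. g x y)" if "finite S" "w \<notin> S" for S
  proof -
    have "(\<Sum>x\<in>S. g x w) = (\<Sum>x\<in>S. g w x)" by (rule sum.cong[OF refl sym])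
    with that assms(5) show ?thesis by (simp add: sum.distrib)
  qed
  have "(\<Sum>x\<in>V1 \<union> V2. \<Sum>y\<in>V1 \<union> V2. g x y) =
      2 * (\<Sum>x\<in>?A \<union> ?B. g w x) + (\<Sum>x\<in>?A \<union> ?B. \<Sum>y\<in>?A \<union> ?B. g x y)"
    unfolding V(3) by (rule ins) (use fins in auto)
  moreover have "(\<Sum>x\<in>V1. \<Sum>y\<in>V1. g x y) = 2 * (\<Sum>x\<in>?A. g w x) + (\<Sum>x\<in>?A. \<Sum>y\<in>?A. g x y)"
    using ins[of ?A] fins V(1) by simp
  moreover have "(\<Sum>x\<in>V2. \<Sum>y\<in>V2. g x y) = 2 * (\<Sum>x\<in>?B. g w x) + (\<Sum>x\<in>?B. \<Sum>y\<in>?B. g x y)"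
    using ins[of ?B] fins V(2) by simp
  ultimately show ?thesis
    using swap by (simp add: sum.union_disjoint[OF fins dis] sum.distrib)
qed

lemma graph_dist_part_le:
  assumes "connected_sgraph V1 E1" "V1 \<subseteq> V" "E1 \<subseteq> E" "x \<in> V1" "y \<in> V1"
  shows "graph_dist V E x y \<le> graph_dist V1 E1 x y"
proof -
  interpret G1: connected_sgraph V1 E1 by fact
  obtain xs where xs: "walk_betw V1 E1 x xs y" "length xs = Suc (graph_dist V1 E1 x y)"
    by (rule G1.geodesic[OF assms(4,5)])
  show ?thesis by (rule graph_dist_le[OF walk_betw_mono[OF xs(1) assms(2,3)] xs(2)])
qed

text \<open>Distances can only shrink from a part to the whole graph, and a crossing pair is joined
  through \<open>w\<close>. Both facts bound distances from above, hence reciprocals from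
  below.\<close>

lemma harary_index_split:
  assumes G: "fin_sgraph V E" "two_edge_connected V E"
    and V: "V = V1 \<union> V2" and cut: "V1 \<inter> V2 = {w}"
    and edges: "\<And>e. e \<in> E \<Longrightarrow> e \<subseteq> V1 \<or> e \<subseteq> V2"
    and card: "1 < card V1" "1 < card V2"
  shows "harary_index V1 {e \<in> E. e \<subseteq> V1} + harary_index V2 {e \<in> E. e \<subseteq> V2}
      + cross_sum (card V1 - 1) (card V2 - 1) \<le> harary_index V E"
proof -
  define E1 where "E1 = {e \<in> E. e \<subseteq> V1}"
  define E2 where "E2 = {e \<in> E. e \<subseteq> V2}"
  have swap: "V2 \<union> V1 = V" "V2 \<inter> V1 = {w}" "\<And>e. e \<in> E \<Longrightarrow> e \<subseteq> V2 \<or> e \<subseteq> V1"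
    using V cut edges by auto
  have fs: "fin_sgraph V1 E1" "fin_sgraph V2 E2"
    using fin_sgraph_part G(1) swap(1) unfolding E1_def E2_def V by (blast, metis Un_commute)
  have tc: "two_edge_connected V1 E1" "two_edge_connected V2 E2"
    unfolding E1_def E2_def
    using two_edge_connected_part[OF _ edges cut card(1)]
      two_edge_connected_part[OF _ swap(3,2) card(2)] G(2) swap(1) V by auto
  interpret G: connected_sgraph V E by (rule two_edge_connected_imp_connected_sgraph[OF G])
  interpret G1: connected_sgraph V1 E1
    by (rule two_edge_connected_imp_connected_sgraph[OF fs(1) tc(1)])
  interpret G2: connected_sgraph V2 E2
    by (rule two_edge_connected_imp_connected_sgraph[OF fs(2) tc(2)])
  have w: "w \<in> V1" "w \<in> V2" "w \<in> V" using cut V by auto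
  have le1: "G.d x y \<le> G1.d x y" if "x \<in> V1" "y \<in> V1" for x y
    by (rule graph_dist_part_le[OF G1.connected_sgraph_axioms]) (use that V E1_def in auto)
  have le2: "G.d x y \<le> G2.d x y" if "x \<in> V2" "y \<in> V2" for x y
    by (rule graph_dist_part_le[OF G2.connected_sgraph_axioms]) (use that V E2_def in auto)
  \<comment> \<open>The case \<open>x = y\<close> is excluded because \<open>1 / 0 = 0\<close>
    breaks the monotonicity of reciprocals.\<close>
  have inv: "1 / real b \<le> 1 / real (G.d x y)" if "G.d x y \<le> b" "x \<in> V" "y \<in> V" "x \<noteq> y" for x y b
  proof -
    have "0 < G.d x y" using G.dist_eq_0_iff that by auto
    then show ?thesis using that(1) by (intro divide_left_mono) auto
  qed
  have part1: "1 / real (G1.d x y) \<le> 1 / real (G.d x y)" if "x \<in> V1" "y \<in> V1" for x y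
    using inv[OF le1[OF that]] that V by (cases "x = y") (auto simp: graph_dist_self)
  have part2: "1 / real (G2.d x y) \<le> 1 / real (G.d x y)" if "x \<in> V2" "y \<in> V2" for x y
    using inv[OF le2[OF that]] that V by (cases "x = y") (auto simp: graph_dist_self)
  obtain f1 where f1: "bij_betw f1 {..<card V1 - 1} (V1 - {w})"
      "\<And>i. i < card V1 - 1 \<Longrightarrow> G1.d w (f1 i) \<le> max 1 i"
    by (rule G1.rank_le_if_first_layer_ge_2[OF w(1) two_edge_connected_first_layer[OF fs(1) tc(1) w(1)]]) blast
  obtain f2 where f2: "bij_betw f2 {..<card V2 - 1} (V2 - {w})"
      "\<And>i. i < card V2 - 1 \<Longrightarrow> G2.d w (f2 i) \<le> max 1 i"
    by (rule G2.rank_le_if_first_layer_ge_2[OF w(2) two_edge_connected_first_layer[OF fs(2) tc(2) w(2)]]) blast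
  have cross: "cross_sum (card V1 - 1) (card V2 - 1)
      \<le> (\<Sum>x\<in>V1 - {w}. \<Sum>y\<in>V2 - {w}. 1 / real (G.d x y))"
    unfolding cross_sum_def sum.reindex_bij_betw[OF f1(1), symmetric]
      sum.reindex_bij_betw[OF f2(1), symmetric]
  proof (intro sum_mono)
    fix i j assume "i \<in> {..<card V1 - 1}" "j \<in> {..<card V2 - 1}"
    then have ij: "i < card V1 - 1" "j < card V2 - 1" by auto
    have fi: "f1 i \<in> V1" "f1 i \<noteq> w" and fj: "f2 j \<in> V2" "f2 j \<noteq> w"
      using f1(1) f2(1) ij by (auto simp: bij_betw_def)
    have neq: "f1 i \<noteq> f2 j" using fi fj cut by (metis IntI singletonD)
    have inV: "f1 i \<in> V" "f2 j \<in> V" unfolding V using fi fj by auto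
    have "G.d (f1 i) (f2 j) \<le> G.d w (f1 i) + G.d w (f2 j)"
      using G.dist_triangle[OF inV(1) w(3) inV(2)] by (simp add: graph_dist_commute[of V E w "f1 i"])
    also have "\<dots> \<le> max 1 i + max 1 j"
      using le1[OF w(1) fi(1)] le2[OF w(2) fj(1)] f1(2)[OF ij(1)] f2(2)[OF ij(2)] by linarith
    finally show "1 / (real (max 1 i) + real (max 1 j)) \<le> 1 / real (G.d (f1 i) (f2 j))"
      using inv[OF _ inV neq] by (metis of_nat_add)
  qed
  have sym: "1 / real (G.d x y) = 1 / real (G.d y x)" for x y by (metis graph_dist_commute)
  have zero: "1 / real (G.d w w) = 0" by (simp add: graph_dist_self[OF w(3)])
  have "2 * harary_index V E = (\<Sum>x\<in>V1. \<Sum>y\<in>V1. 1 / real (G.d x y))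
      + (\<Sum>x\<in>V2. \<Sum>y\<in>V2. 1 / real (G.d x y))
      + 2 * (\<Sum>x\<in>V1 - {w}. \<Sum>y\<in>V2 - {w}. 1 / real (G.d x y))"
    unfolding G.harary_index_eq_sum
    by (rule sum_over_split[OF G1.finite_verts G2.finite_verts cut,
          of "\<lambda>x y. 1 / real (G.d x y)", OF sym zero, folded V])
  moreover have "2 * harary_index V1 E1 \<le> (\<Sum>x\<in>V1. \<Sum>y\<in>V1. 1 / real (G.d x y))"
    unfolding G1.harary_index_eq_sum by (intro sum_mono part1)
  moreover have "2 * harary_index V2 E2 \<le> (\<Sum>x\<in>V2. \<Sum>y\<in>V2. 1 / real (G.d x y))"
    unfolding G2.harary_index_eq_sum by (intro sum_mono part2)
  ultimately show ?thesis using cross unfolding E1_def E2_def by linarith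
qed

section \<open>The lower bound by induction on the number of vertices\<close>

text \<open>Gluing is strict, so in the split case the inequality for the two parts is enough and
  equality is impossible. The equality clause is decided entirely in the case without a singleton
  layer.\<close>

lemma harary_index_ge:
  assumes "fin_sgraph V E" "two_edge_connected V E"
  shows "cycle_harary (card V - 1) \<le> harary_index V E \<and>
    (harary_index V E = cycle_harary (card V - 1) \<longrightarrow>
      (\<forall>u\<in>V. card {v \<in> V. {u, v} \<in> E} = 2))"
  using assms
proof (induction "card V" arbitrary: V E rule: less_induct)
  case less
  interpret connected_sgraph V E
    by (rule two_edge_connected_imp_connected_sgraph[OF less.prems])
  have first: "2 \<le> card (layer w 1)" if "w \<in> V" for w
    by (rule two_edge_connected_first_layer[OF less.prems that])
  show ?case
  proof (cases "\<forall>w\<in>V. \<forall>k v. 0 < k \<longrightarrow> v \<in> V \<longrightarrow> k < d w v \<longrightarrow> 2 \<le> card (layer w k)")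
    case True
    then have *: "half_sum (card V - 1) \<le> (\<Sum>v\<in>V. 1 / real (d w v))"
        "2 < card (layer w 1) \<Longrightarrow> half_sum (card V - 1) < (\<Sum>v\<in>V. 1 / real (d w v))"
      if "w \<in> V" for w
      using half_sum_le_inverse_dist_sum[OF that] that by blast+
    have "card V \<noteq> 0" using less.prems by (auto simp: two_edge_connected_def)
    then have c: "2 * cycle_harary (card V - 1) = (\<Sum>w\<in>V. half_sum (card V - 1))"
      by (simp add: cycle_harary_def of_nat_diff)
    have le: "2 * cycle_harary (card V - 1) \<le> 2 * harary_index V E"
      unfolding c harary_index_eq_sum using * by (intro sum_mono)
    have "card {v \<in> V. {u, v} \<in> E} = 2"
      if eq: "harary_index V E = cycle_harary (card V - 1)" and u: "u \<in> V" for u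
    proof -
      \<comment> \<open>A third neighbour at a single vertex already makes the total strict.\<close>
      have "\<not> 2 < card (layer u 1)"
      proof
        assume "2 < card (layer u 1)"
        then have "2 * cycle_harary (card V - 1) < 2 * harary_index V E"
          unfolding c harary_index_eq_sum using * u finite_verts by (intro sum_strict_mono_ex1) auto
        with eq show False by simp
      qed
      moreover have "layer u 1 = {v \<in> V. {u, v} \<in> E}"
        using dist_eq_1_iff[OF u] by (auto simp: layer_def)
      ultimately show ?thesis using first[OF u] by simp
    qed
    with le show ?thesis by auto
  next
    case False
    then obtain u k y where u: "u \<in> V" "0 < k" "y \<in> V" "k < d u y" "card (layer u k) < 2"
      by (auto simp: not_le)
    then have "card (layer u k) = 1" using card_layer_pos[of u y k] by simp
    then obtain w where w: "layer u k = {w}" by (auto simp: card_1_singleton_iff)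
    \<comment> \<open>Layer \<open>k\<close> is put into both parts, so that they overlap exactly in
      \<open>w\<close>.\<close>
    define V1 where "V1 = {x \<in> V. d u x \<le> k}"
    define V2 where "V2 = {x \<in> V. k \<le> d u x}"
    have V: "V = V1 \<union> V2" by (auto simp: V1_def V2_def)
    have "V1 \<inter> V2 = layer u k" by (auto simp: V1_def V2_def layer_def)
    with w have cut: "V1 \<inter> V2 = {w}" by simp
    have "w \<in> layer u k" using w by simp
    then have wV: "w \<in> V" "d u w = k" by (simp_all add: layer_def)
    \<comment> \<open>Distances from \<open>u\<close> change by at most one along an edge, so no
      edge jumps over layer \<open>k\<close>.\<close>
    have edges: "e \<subseteq> V1 \<or> e \<subseteq> V2" if eE: "e \<in> E" for e
    proof -
      obtain a b where ab: "e = {a, b}" using edge_card[OF eE] by (auto simp: card_2_iff)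
      with eE have e: "{a, b} \<in> E" "{b, a} \<in> E" by (simp_all add: insert_commute)
      have "d u a \<le> Suc (d u b)" "d u b \<le> Suc (d u a)"
        using dist_adjacent_le[OF u(1)] e by blast+
      then have "d u a \<le> k \<and> d u b \<le> k \<or> k \<le> d u a \<and> k \<le> d u b" by linarith
      then show ?thesis
        using adjacent_in_verts(1,2)[OF e(1)] by (auto simp: ab V1_def V2_def)
    qed
    have fin: "finite V1" "finite V2" using finite_verts by (auto simp: V1_def V2_def)
    \<comment> \<open>\<open>0 < k\<close> places \<open>u\<close> before the layer and
      \<open>k < d u y\<close> places \<open>y\<close> beyond it. Each part thus has a vertex
      besides \<open>w\<close>, which makes the other part smaller than \<open>V\<close>.\<close>
    have "w \<noteq> u" "w \<noteq> y" "{w, u} \<subseteq> V1" "{w, y} \<subseteq> V2"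
      using wV u by (auto simp: V1_def V2_def graph_dist_self)
    then have card: "1 < card V1" "1 < card V2"
      using card_mono[OF fin(1), of "{w, u}"] card_mono[OF fin(2), of "{w, y}"] by auto
    have sum: "card V1 + card V2 = card V + 1"
      using card_Un_Int[OF fin] V cut by simp
    have swap: "V = V2 \<union> V1" "V2 \<inter> V1 = {w}" "\<And>e. e \<in> E \<Longrightarrow> e \<subseteq> V2 \<or> e \<subseteq> V1"
      using V cut edges by auto
    have fs: "fin_sgraph V1 {e \<in> E. e \<subseteq> V1}" "fin_sgraph V2 {e \<in> E. e \<subseteq> V2}"
      by (rule fin_sgraph_part[OF less.prems(1)[unfolded V]],
          rule fin_sgraph_part[OF less.prems(1)[unfolded swap(1)]])
    have tc: "two_edge_connected V1 {e \<in> E. e \<subseteq> V1}" "two_edge_connected V2 {e \<in> E. e \<subseteq> V2}"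
      by (rule two_edge_connected_part[OF less.prems(2)[unfolded V] edges cut card(1)], assumption,
          rule two_edge_connected_part[OF less.prems(2)[unfolded swap(1)] swap(3,2) card(2)], assumption)
    have IH: "cycle_harary (card V1 - 1) \<le> harary_index V1 {e \<in> E. e \<subseteq> V1}"
        "cycle_harary (card V2 - 1) \<le> harary_index V2 {e \<in> E. e \<subseteq> V2}"
      using less.hyps[OF _ fs(1) tc(1)] less.hyps[OF _ fs(2) tc(2)] sum card by auto
    have ge: "2 \<le> card V1 - 1" "2 \<le> card V2 - 1"
      using two_edge_connected_card_ge_3[OF fs(1) tc(1)] two_edge_connected_card_ge_3[OF fs(2) tc(2)]
      by auto
    have "card V - 1 = (card V1 - 1) + (card V2 - 1)" using sum card by simp
    with cycle_harary_split[OF ge] IH harary_index_split[OF less.prems V cut edges card]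
    have "cycle_harary (card V - 1) < harary_index V E" by simp
    then show ?thesis by simp
  qed
qed

section \<open>Connected 2-regular graphs are cycles\<close>

lemma successively_nth_iff:
  "successively P xs \<longleftrightarrow> (\<forall>i. Suc i < length xs \<longrightarrow> P (xs ! i) (xs ! Suc i))"
  by (induction xs rule: induct_list012) (auto simp: nth_Cons split: nat.splits)

lemma walk_stays_in_closed_set:
  assumes "successively (\<lambda>x y. {x, y} \<in> E) xs" "xs \<noteq> []" "hd xs \<in> S"
    and "\<And>x y. x \<in> S \<Longrightarrow> {x, y} \<in> E \<Longrightarrow> y \<in> S"
  shows "last xs \<in> S"
  using assms(1-3)
proof (induction xs rule: induct_list012)
  case (3 x y zs)
  then show ?case using assms(4)[of x y] by simp
qed auto

lemma doubleton_in_cycle_edges_iff: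
  assumes "i < n" "j < n"
  shows "{i, j} \<in> cycle_edges n \<longleftrightarrow> j = Suc i mod n \<or> i = Suc j mod n"
  using assms unfolding cycle_edges_def by (auto simp: doubleton_eq_iff)

context connected_sgraph
begin

text \<open>Take a longest path. Both neighbours of its last vertex lie on it, and the inner
  vertices have their degree used up, so the path closes at its first vertex. The resulting cycle is
  closed under adjacency and by connectedness contains all of \<open>V\<close>.\<close>

lemma two_regular_imp_cycle:
  assumes deg: "\<And>u. u \<in> V \<Longrightarrow> card {v \<in> V. {u, v} \<in> E} = 2"
  shows "graph_iso V E (cycle_verts (card V)) (cycle_edges (card V))"
proof -
  define N where "N u = {v \<in> V. {u, v} \<in> E}" for u
  define path where
    "path xs \<longleftrightarrow> xs \<noteq> [] \<and> distinct xs \<and> set xs \<subseteq> V \<and> successively (\<lambda>x y. {x, y} \<in> E) xs" for xs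
  have N: "y \<in> N x \<longleftrightarrow> {x, y} \<in> E" for x y using adjacent_in_verts by (auto simp: N_def)
  have N_sym: "y \<in> N x \<longleftrightarrow> x \<in> N y" for x y by (simp add: N insert_commute)
  have N_eq: "N u = {a, b}" if "u \<in> V" "a \<in> N u" "b \<in> N u" "a \<noteq> b" for u a b
    by (rule card_subset_eq[symmetric])
      (use that deg[of u] finite_verts in \<open>auto simp: N_def\<close>)
  obtain u0 where "u0 \<in> V" using connected by (auto simp: graph_connected_def)
  then have "path [u0]" by (simp add: path_def)
  moreover have bound: "length xs < Suc (card V)" if "path xs" for xs
    using that card_mono[OF finite_verts, of "set xs"] distinct_card[of xs] by (simp add: path_def)
  ultimately obtain xs where xs: "path xs" and max: "\<And>ys. path ys \<Longrightarrow> length ys \<le> length xs"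
    using ex_has_greatest_nat[of path "[u0]" length "Suc (card V)"] by (metis less_imp_le_nat)
  define m where "m = length xs"
  have m: "0 < m" using xs by (simp add: m_def path_def)
  have x_in: "xs ! i \<in> V" if "i < m" for i
    using xs that nth_mem[of i xs] by (auto simp: m_def path_def)
  have x_eq: "xs ! i = xs ! j \<longleftrightarrow> i = j" if "i < m" "j < m" for i j
    using xs that by (simp add: m_def path_def nth_eq_iff_index_eq)
  have x_edge: "xs ! Suc i \<in> N (xs ! i)" "xs ! i \<in> N (xs ! Suc i)" if "Suc i < m" for i
    using xs that by (auto simp: N insert_commute m_def path_def successively_nth_iff)
  have inner: "N (xs ! Suc i) = {xs ! i, xs ! Suc (Suc i)}" if "Suc (Suc i) < m" for i
    by (rule N_eq) (use x_in x_eq x_edge that in auto)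
  define z where "z = xs ! (m - 1)"
  have zV: "z \<in> V" using x_in m by (simp add: z_def)
  have last: "last xs = z" using xs by (simp add: z_def m_def path_def last_conv_nth)
  \<comment> \<open>For \<open>m = 2\<close> the first vertex is also \<open>xs ! (m - 2)\<close>.
    With \<open>2 < m\<close> in the first alternative, two distinct neighbours of \<open>z\<close>
    force \<open>2 < m\<close>.\<close>
  have endN: "y = xs ! 0 \<and> 2 < m \<or> 1 < m \<and> y = xs ! (m - 2)" if y: "y \<in> N z" for y
  proof -
    have "y \<in> set xs"
    proof (rule ccontr)
      assume "y \<notin> set xs"
      moreover have "y \<in> V" "{z, y} \<in> E" using y by (auto simp: N_def)
      ultimately have "path (xs @ [y])"
        using xs last by (simp add: path_def successively_append_iff)
      from max[OF this] show False by simp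
    qed
    then obtain j where j: "j < m" "y = xs ! j" by (auto simp: in_set_conv_nth m_def)
    have "y \<noteq> z" using y adjacent_in_verts(3)[of z y] by (simp add: N)
    then have "j \<noteq> m - 1" using j by (auto simp: z_def)
    then have j': "Suc j < m" using j by simp
    show ?thesis
    proof (cases j)
      case 0
      then show ?thesis using j j' by (cases "m = 2") auto
    next
      case (Suc i)
      \<comment> \<open>An inner vertex is adjacent only to its two neighbours on the path, so
        \<open>z\<close> must be one of them.\<close>
      then have "z \<in> {xs ! i, xs ! Suc (Suc i)}" using y j j' inner[of i] N_sym by auto
      then have "m - 1 = i \<or> m - 1 = Suc (Suc i)"
        using x_eq[of "m - 1" i] x_eq[of "m - 1" "Suc (Suc i)"] j' Suc by (auto simp: z_def)
      then have "j = m - 2" using Suc j' by auto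
      then show ?thesis using j j' by auto
    qed
  qed
  have "card (N z) = 2" using deg[OF zV] by (simp add: N_def)
  then obtain a b where ab: "N z = {a, b}" "a \<noteq> b" by (auto simp: card_2_iff)
  then have m3: "2 < m" and zN: "N z = {xs ! 0, xs ! (m - 2)}"
    using endN[of a] endN[of b] by auto
  have startN: "N (xs ! 0) = {xs ! 1, z}"
  proof (rule N_eq)
    show "z \<in> N (xs ! 0)" using zN N_sym by auto
    show "xs ! 1 \<noteq> z" using x_eq[of 1 "m - 1"] m3 by (simp add: z_def)
  qed (use x_in x_edge[of 0] m3 in auto)
  have N_next: "xs ! j \<in> N (xs ! i) \<longleftrightarrow> j = Suc i mod m \<or> i = Suc j mod m"
    if ij: "i < m" "j < m" for i j
  proof -
    consider "i = 0" | "i = m - 1" | k where "i = Suc k" "Suc (Suc k) < m"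
      using ij by (cases i) fastforce+
    then show ?thesis
    proof cases
      case 1
      then have "xs ! j \<in> N (xs ! i) \<longleftrightarrow> j = 1 \<or> j = m - 1"
        using startN x_eq[of j] ij m3 by (auto simp: z_def)
      also have "\<dots> \<longleftrightarrow> j = Suc i mod m \<or> i = Suc j mod m"
        using 1 ij m3 by (auto simp: mod_Suc)
      finally show ?thesis .
    next
      case 2
      then have "xs ! j \<in> N (xs ! i) \<longleftrightarrow> j = 0 \<or> j = m - 2"
        using zN x_eq[of j] ij m3 by (auto simp: z_def)
      also have "\<dots> \<longleftrightarrow> j = Suc i mod m \<or> i = Suc j mod m"
        using 2 ij m3 by (auto simp: mod_Suc)
      finally show ?thesis .
    next
      case (3 k)
      then have "xs ! j \<in> N (xs ! i) \<longleftrightarrow> j = k \<or> j = Suc (Suc k)"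
        using inner x_eq[of j] ij by auto
      also have "\<dots> \<longleftrightarrow> j = Suc i mod m \<or> i = Suc j mod m"
        using 3 ij m3 by (auto simp: mod_Suc)
      finally show ?thesis .
    qed
  qed
  have closed: "y \<in> set xs" if xy: "x \<in> set xs" "{x, y} \<in> E" for x y
  proof -
    obtain i where i: "i < m" "x = xs ! i" using xy(1) by (auto simp: in_set_conv_nth m_def)
    have mem: "xs ! k \<in> set xs" if "k < m" for k using that by (simp add: m_def)
    have "y \<in> N x" using xy(2) by (simp add: N)
    consider "i = 0" | "i = m - 1" | k where "i = Suc k" "Suc (Suc k) < m"
      using i by (cases i) fastforce+
    then show ?thesis
    proof cases
      case 1
      then show ?thesis using startN i \<open>y \<in> N x\<close> m3 mem[of 1] mem[of "m - 1"] by (auto simp: z_def)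
    next
      case 2
      then show ?thesis using zN i \<open>y \<in> N x\<close> m3 mem[of 0] mem[of "m - 2"] by (auto simp: z_def)
    next
      case (3 k)
      then show ?thesis using inner[of k] i \<open>y \<in> N x\<close> mem[of k] mem[of "Suc (Suc k)"] by auto
    qed
  qed
  have "V \<subseteq> set xs"
  proof
    fix v assume "v \<in> V"
    then obtain ys where ys: "walk_betw V E (xs ! 0) ys v"
      using connected x_in[OF m] unfolding graph_connected_def by blast
    then have "last ys \<in> set xs"
      using m by (intro walk_stays_in_closed_set[of E ys "set xs"])
        (auto simp: walk_betw_def m_def closed)
    then show "v \<in> set xs" using ys by (simp add: walk_betw_def)
  qed
  then have set_xs: "set xs = V" using xs by (auto simp: path_def)
  then have mV: "m = card V" using xs distinct_card by (fastforce simp: m_def path_def)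
  have bij: "bij_betw ((!) xs) {..<m} V"
    using bij_betw_nth[of xs "{..<m}" V] xs set_xs by (simp add: m_def path_def)
  \<comment> \<open>The isomorphism sends each vertex to its position on the path.\<close>
  define f where "f = the_inv_into {..<m} ((!) xs)"
  have f: "bij_betw f V {..<m}" unfolding f_def by (rule bij_betw_the_inv_into[OF bij])
  have xf: "xs ! f u = u" if "u \<in> V" for u
    unfolding f_def using bij that by (auto simp: bij_betw_def intro!: f_the_inv_into_f)
  show ?thesis
    unfolding graph_iso_def
  proof (intro exI conjI ballI)
    show "bij_betw f V (cycle_verts (card V))" using f mV by (simp add: cycle_verts_def)
    fix u v assume uv: "u \<in> V" "v \<in> V"
    then have lt: "f u < m" "f v < m" using bij_betwE[OF f] by auto
    have "{u, v} \<in> E \<longleftrightarrow> xs ! f v \<in> N (xs ! f u)" using uv xf by (simp add: N)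
    then show "{u, v} \<in> E \<longleftrightarrow> {f u, f v} \<in> cycle_edges (card V)"
      using N_next[OF lt] doubleton_in_cycle_edges_iff lt mV by simp
  qed
qed

end

section \<open>Distances and the Harary index of the cycle\<close>

lemma cycle_connected:
  assumes "0 < n"
  shows "graph_connected (cycle_verts n) (cycle_edges n)"
proof -
  have up: "walk_betw (cycle_verts n) (cycle_edges n) 0 [0..<Suc i] i" if "i < n" for i
  proof -
    have "successively (\<lambda>x y. {x, y} \<in> cycle_edges n) [0..<Suc i]"
      using that by (auto simp: successively_nth_iff doubleton_in_cycle_edges_iff simp del: upt_Suc)
    moreover have "hd [0..<Suc i] = 0" "last [0..<Suc i] = i"
      by (simp_all only: hd_upt last_upt zero_less_Suc diff_Suc_1)
    ultimately show ?thesis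
      using that unfolding walk_betw_def cycle_verts_def by (auto simp del: upt_Suc)
  qed
  have "\<exists>xs. walk_betw (cycle_verts n) (cycle_edges n) u xs v" if "u < n" "v < n" for u v
    using walk_betw_append[OF walk_betw_rev[OF up[OF that(1)]] up[OF that(2)]] by blast
  then show ?thesis using assms by (auto simp: graph_connected_def cycle_verts_def)
qed

text \<open>Lifting to the integers: each edge moves by 1 or -1 modulo \<open>n\<close>, and
  \<open>s\<close> is the sum of these moves.\<close>

lemma cycle_walk_displacement:
  assumes "xs \<noteq> []" "set xs \<subseteq> {..<n}" "successively (\<lambda>x y. {x, y} \<in> cycle_edges n) xs"
  shows "\<exists>s. \<bar>s\<bar> \<le> int (length xs) - 1 \<and> int (last xs) = (int (hd xs) + s) mod int n"
  using assms
proof (induction xs rule: induct_list012)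
  case (3 x y zs)
  then obtain s where s: "\<bar>s\<bar> \<le> int (length (y # zs)) - 1"
      "int (last (y # zs)) = (int y + s) mod int n" by auto
  have "y = Suc x mod n \<or> x = Suc y mod n"
    using 3 by (auto simp: doubleton_in_cycle_edges_iff)
  then obtain t where t: "\<bar>t\<bar> \<le> 1" "int y mod int n = (int x + t) mod int n"
  proof
    assume "y = Suc x mod n"
    then show thesis by (intro that[of 1]) (simp_all add: zmod_int add.commute)
  next
    assume "x = Suc y mod n"
    then have "(int x - 1) mod int n = int y mod int n" by (simp add: zmod_int mod_simps)
    then show thesis by (intro that[of "-1"]) simp_all
  qed
  have "int (last (x # y # zs)) = (int x + (t + s)) mod int n"
    using s(2) t(2) by (metis add.assoc last_ConsR list.distinct(1) mod_add_left_eq)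
  then show ?case using s(1) t(1) by (intro exI[of _ "t + s"]) auto
qed auto

text \<open>Such vertices are \<open>i + s\<close> modulo \<open>n\<close> with \<open>s\<close>
  between \<open>- k\<close> and \<open>k\<close>; \<open>s = 0\<close> would give \<open>i\<close>
  itself, which leaves \<open>2 * k\<close> values.\<close>

lemma cycle_ball_card:
  assumes "3 \<le> n" "i < n"
  shows "card {j \<in> {..<n} - {i}. graph_dist (cycle_verts n) (cycle_edges n) i j \<le> k} \<le> 2 * k"
proof -
  interpret connected_sgraph "cycle_verts n" "cycle_edges n"
    using fin_sgraph_cycle[OF assms(1)] cycle_connected assms(1)
    by (simp add: connected_sgraph_def connected_sgraph_axioms_def)
  let ?S = "{- int k..int k} - {0}"
  have "{j \<in> {..<n} - {i}. d i j \<le> k} \<subseteq> (\<lambda>s. nat ((int i + s) mod int n)) ` ?S"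
  proof
    fix j assume j: "j \<in> {j \<in> {..<n} - {i}. d i j \<le> k}"
    then obtain xs where xs: "walk_betw (cycle_verts n) (cycle_edges n) i xs j"
        "length xs = Suc (d i j)"
      using geodesic[of i j] assms by (auto simp: cycle_verts_def)
    then obtain s where s: "\<bar>s\<bar> \<le> int (d i j)" "int j = (int i + s) mod int n"
      using cycle_walk_displacement[of xs n] by (auto simp: walk_betw_def cycle_verts_def)
    have "s \<noteq> 0" using s(2) j assms(2) by auto
    then have "s \<in> ?S" using s(1) j by auto
    moreover have "j = nat ((int i + s) mod int n)" using s(2) by simp
    ultimately show "j \<in> (\<lambda>s. nat ((int i + s) mod int n)) ` ?S" by blast
  qed
  from surj_card_le[OF _ this] show ?thesis by (simp add: card_Diff_singleton)
qed

text \<open>The \<open>i\<close>-th other vertex, at distance \<open>d\<close>, has more than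
  \<open>i\<close> other vertices in its ball, while the ball has at most \<open>2 * d\<close>; so
  \<open>d\<close> is at least \<open>i div 2 + 1\<close>.\<close>

lemma harary_index_cycle_le:
  assumes "3 \<le> n"
  shows "harary_index (cycle_verts n) (cycle_edges n) \<le> cycle_harary (n - 1)"
proof -
  interpret connected_sgraph "cycle_verts n" "cycle_edges n"
    using fin_sgraph_cycle[OF assms(1)] cycle_connected assms(1)
    by (simp add: connected_sgraph_def connected_sgraph_axioms_def)
  have vert: "(\<Sum>v<n. 1 / real (d w v)) \<le> half_sum (n - 1)" if w: "w < n" for w
  proof -
    have card: "card ({..<n} - {w}) = n - 1" using w by simp
    obtain f where f: "bij_betw f {..<card ({..<n} - {w})} ({..<n} - {w})"
      and rank: "\<And>i. i < card ({..<n} - {w}) \<Longrightarrow> i < card {y \<in> {..<n} - {w}. d w y \<le> d w (f i)}"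
      using enumerate_by_rank[of "{..<n} - {w}" "d w"] by blast
    have "(\<Sum>v<n. 1 / real (d w v)) = (\<Sum>v\<in>{..<n} - {w}. 1 / real (d w v))"
      using w by (subst sum.remove[of _ w]) (auto simp: graph_dist_self cycle_verts_def)
    also have "\<dots> = (\<Sum>i<n - 1. 1 / real (d w (f i)))"
      using sum.reindex_bij_betw[OF f, symmetric] card by simp
    also have "\<dots> \<le> half_sum (n - 1)"
      unfolding half_sum_def
    proof (rule sum_mono)
      fix i assume "i \<in> {..<n - 1}"
      then have "i < 2 * d w (f i)"
        using rank[of i] cycle_ball_card[OF assms w, of "d w (f i)"] card by simp
      then have "i div 2 + 1 \<le> d w (f i)" by simp
      then have "real (i div 2) + 1 \<le> real (d w (f i))" by linarith
      then show "1 / real (d w (f i)) \<le> 1 / (real (i div 2) + 1)"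
        by (intro divide_left_mono) auto
    qed
    finally show ?thesis .
  qed
  have "2 * harary_index (cycle_verts n) (cycle_edges n) \<le> (\<Sum>w<n. half_sum (n - 1))"
    unfolding harary_index_eq_sum unfolding cycle_verts_def[of n]
    using vert by (intro sum_mono) (simp add: cycle_verts_def)
  also have "\<dots> = 2 * cycle_harary (n - 1)"
    using assms by (simp add: cycle_harary_def of_nat_diff)
  finally show ?thesis by simp
qed

section \<open>Invariance under isomorphism\<close>

lemma walk_betw_image:
  assumes "walk_betw V E u xs v" "f ` V \<subseteq> V'"
    and "\<And>x y. x \<in> V \<Longrightarrow> y \<in> V \<Longrightarrow> {x, y} \<in> E \<Longrightarrow> {f x, f y} \<in> E'"
  shows "walk_betw V' E' (f u) (map f xs) (f v)"
proof -
  have xs: "xs \<noteq> []" "hd xs = u" "last xs = v" "set xs \<subseteq> V" "successively (\<lambda>x y. {x, y} \<in> E) xs"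
    using assms(1) by (simp_all add: walk_betw_def)
  have "successively (\<lambda>x y. {f x, f y} \<in> E') xs"
    using xs(5) by (auto simp: successively_nth_iff intro!: assms(3) subsetD[OF xs(4)])
  moreover have "f ` set xs \<subseteq> V'" using xs(4) assms(2) by blast
  ultimately show ?thesis using xs(1-3) by (simp add: walk_betw_def hd_map last_map successively_map)
qed

text \<open>Walks are carried over by \<open>f\<close> and back by its inverse with their lengths
  unchanged, so both minima range over the same lengths.\<close>

lemma graph_dist_image:
  assumes "bij_betw f V V'" "\<forall>u\<in>V. \<forall>v\<in>V. {u, v} \<in> E \<longleftrightarrow> {f u, f v} \<in> E'"
    and "u \<in> V" "v \<in> V"
  shows "graph_dist V' E' (f u) (f v) = graph_dist V E u v"
proof -
  define g where "g = the_inv_into V f"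
  have g: "g ` V' \<subseteq> V" "\<And>x. x \<in> V \<Longrightarrow> g (f x) = x" "\<And>y. y \<in> V' \<Longrightarrow> f (g y) = y" "f ` V = V'"
    using assms(1) by (auto simp: g_def bij_betw_def the_inv_into_f_f f_the_inv_into_f
      the_inv_into_into)
  have "(\<exists>xs. walk_betw V E u xs v \<and> length xs = Suc k) \<longleftrightarrow>
        (\<exists>xs. walk_betw V' E' (f u) xs (f v) \<and> length xs = Suc k)" for k
  proof
    assume "\<exists>xs. walk_betw V E u xs v \<and> length xs = Suc k"
    then obtain xs where xs: "walk_betw V E u xs v" "length xs = Suc k" by blast
    have "walk_betw V' E' (f u) (map f xs) (f v)"
      by (rule walk_betw_image[OF xs(1)]) (use assms(2) g(4) in auto)
    then show "\<exists>xs. walk_betw V' E' (f u) xs (f v) \<and> length xs = Suc k" using xs(2) by force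
  next
    assume "\<exists>xs. walk_betw V' E' (f u) xs (f v) \<and> length xs = Suc k"
    then obtain xs where xs: "walk_betw V' E' (f u) xs (f v)" "length xs = Suc k" by blast
    have "walk_betw V E (g (f u)) (map g xs) (g (f v))"
      by (rule walk_betw_image[OF xs(1) g(1)]) (use assms(2) g in \<open>auto simp: image_subset_iff\<close>)
    then show "\<exists>xs. walk_betw V E u xs v \<and> length xs = Suc k"
      using xs(2) g(2) assms(3,4) by force
  qed
  then show ?thesis by (simp add: graph_dist_def)
qed

lemma harary_index_iso:
  assumes "connected_sgraph V E" "connected_sgraph V' E'" "graph_iso V E V' E'"
  shows "harary_index V E = harary_index V' E'"
proof -
  interpret G: connected_sgraph V E by fact
  interpret G': connected_sgraph V' E' by fact
  obtain f where f: "bij_betw f V V'" "\<forall>u\<in>V. \<forall>v\<in>V. {u, v} \<in> E \<longleftrightarrow> {f u, f v} \<in> E'"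
    using assms(3) by (auto simp: graph_iso_def)
  have "2 * harary_index V' E' = (\<Sum>u\<in>V. \<Sum>v\<in>V. 1 / real (G'.d (f u) (f v)))"
    unfolding G'.harary_index_eq_sum sum.reindex_bij_betw[OF f(1), symmetric] ..
  also have "\<dots> = 2 * harary_index V E"
    unfolding G.harary_index_eq_sum using graph_dist_image[OF f] by simp
  finally show ?thesis by simp
qed

theorem theorem5:
  fixes V :: "'a set" and E :: "'a set set" and n :: nat
  assumes "fin_sgraph V E"
    and "two_edge_connected V E"
    and "card V = n"
  shows "harary_index V E \<ge> harary_index (cycle_verts n) (cycle_edges n) \<and>
    (harary_index V E = harary_index (cycle_verts n) (cycle_edges n) \<longleftrightarrow>
      graph_iso V E (cycle_verts n) (cycle_edges n))"
proof -
  interpret G: connected_sgraph V E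
    by (rule two_edge_connected_imp_connected_sgraph[OF assms(1,2)])
  have n: "3 \<le> n" using two_edge_connected_card_ge_3[OF assms(1,2)] assms(3) by simp
  have C: "connected_sgraph (cycle_verts n) (cycle_edges n)"
    using fin_sgraph_cycle[OF n] cycle_connected n
    by (simp add: connected_sgraph_def connected_sgraph_axioms_def)
  \<comment> \<open>\<open>cycle_harary (n - 1)\<close> lies between the two Harary indices, so
    their equality forces equality in \<open>harary_index_ge\<close> and hence degree 2
    everywhere.\<close>
  note bounds = harary_index_ge[OF assms(1,2)] harary_index_cycle_le[OF n]
  show ?thesis
  proof (intro conjI iffI)
    show "harary_index (cycle_verts n) (cycle_edges n) \<le> harary_index V E"
      using bounds assms(3) by simp
    assume "harary_index V E = harary_index (cycle_verts n) (cycle_edges n)"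
    then have "\<forall>u\<in>V. card {v \<in> V. {u, v} \<in> E} = 2" using bounds assms(3) by simp
    then show "graph_iso V E (cycle_verts n) (cycle_edges n)"
      using G.two_regular_imp_cycle assms(3) by simp
  next
    assume "graph_iso V E (cycle_verts n) (cycle_edges n)"
    then show "harary_index V E = harary_index (cycle_verts n) (cycle_edges n)"
      by (rule harary_index_iso[OF G.connected_sgraph_axioms C])
  qed
qed

end
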